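(* The dicyclic group $\mathrm{Dic}_6=\langle x,y \mid x^{12}=1,\ y^2=x^6,\ yxy^{-1}=x^{-1}\rangle$ of order $24$ has an irreducible complex character that is regular invertible but not minimal.
   Context: Let $G$ be a finite group. A virtual character of $G$ is an integer linear combination of irreducible complex characters of $G$; $\rho_{\mathrm{reg}}$ is the regular character. A character $\chi$ is regular invertible if there is a virtual character $\varphi$ of $G$ with $\chi\otimes\varphi=\rho_{\mathrm{reg}}$ (pointwise product of characters). Define a pre-order on the set of virtual complex characters of $G$ of strictly positive degree by: $\chi\le\varphi$ if $\chi(\mathrm{id})\le\varphi(\mathrm{id})$ and, for all $g\in G$, $\varphi(g)=0$ implies $\chi(g)=0$. A virtual character $\chi$ of strictly positive degree is minimal if for every virtual character $\varphi$ of strictly positive degree, $\varphi\le\chi$ implies $\chi\le\varphi$. *)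

theory Defs
  imports
    "HOL-Algebra.Coset"
    "Jordan_Normal_Form.VS_Connect"
begin

hide_const (open) Polynomial.order
hide_fact (open) Polynomial.order_def

section \<open>Groups given by generators and relations\<close>

text \<open>
  A word over the generators is a list of letters; \<open>(a, True)\<close> stands for the generator \<open>a\<close> and
  \<open>(a, False)\<close> for its formal inverse.  All elements of the type \<^typ>\<open>'a\<close> are generators.
\<close>

type_synonym 'a word = "('a \<times> bool) list"

abbreviation gen :: "'a \<Rightarrow> 'a word" where
  "gen a \<equiv> [(a, True)]"

abbreviation gen_inv :: "'a \<Rightarrow> 'a word" where
  "gen_inv a \<equiv> [(a, False)]"

definition gen_pow :: "'a \<Rightarrow> nat \<Rightarrow> 'a word" where
  "gen_pow a k = replicate k (a, True)"

text \<open>The least congruence on words that contains free cancellation and the relations \<open>R\<close>.\<close>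

inductive word_eq :: "('a word \<times> 'a word) set \<Rightarrow> 'a word \<Rightarrow> 'a word \<Rightarrow> bool"
  for R :: "('a word \<times> 'a word) set" where
  rel: "(u, v) \<in> R \<Longrightarrow> word_eq R u v"
| cancel: "word_eq R [(a, b), (a, \<not> b)] []"
| refl: "word_eq R u u"
| sym: "word_eq R u v \<Longrightarrow> word_eq R v u"
| trans: "word_eq R u v \<Longrightarrow> word_eq R v w \<Longrightarrow> word_eq R u w"
| append: "word_eq R u v \<Longrightarrow> word_eq R s t \<Longrightarrow> word_eq R (u @ s) (v @ t)"

definition word_class :: "('a word \<times> 'a word) set \<Rightarrow> 'a word \<Rightarrow> 'a word set" where
  "word_class R u = {v. word_eq R u v}"

definition presented_group :: "('a word \<times> 'a word) set \<Rightarrow> 'a word set monoid" where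
  "presented_group R =
    \<lparr> carrier = range (word_class R),
      monoid.mult = (\<lambda>A B. {w. \<exists>u\<in>A. \<exists>v\<in>B. word_eq R (u @ v) w}),
      one = word_class R [] \<rparr>"

lemma word_class_eq_iff: "word_class R u = word_class R v \<longleftrightarrow> word_eq R u v"
  unfolding word_class_def by (auto intro: word_eq.intros)

lemma presented_group_mult:
  "word_class R u \<otimes>\<^bsub>presented_group R\<^esub> word_class R v = word_class R (u @ v)"
  unfolding presented_group_def word_class_def
  by (auto intro: word_eq.intros)

lemma word_eq_inverse_left:
  "word_eq R (rev (map (\<lambda>(a, b). (a, \<not> b)) u) @ u) []"
proof (induction u)
  case Nil
  show ?case by (simp add: word_eq.refl)
next
  case (Cons x u)
  obtain a b where x: "x = (a, b)" by (cases x)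
  let ?v = "rev (map (\<lambda>(a, b). (a, \<not> b)) u)"
  have "word_eq R [(a, \<not> b), (a, b)] []"
    using word_eq.cancel[of R a "\<not> b"] by simp
  then have "word_eq R (?v @ ([(a, \<not> b), (a, b)] @ u)) (?v @ ([] @ u))"
    by (intro word_eq.append word_eq.refl)
  then show ?case
    using Cons.IH x by (auto intro: word_eq.trans)
qed

lemma group_presented_group: "group (presented_group R)"
proof (rule groupI)
  let ?G = "presented_group R"
  have carrier: "carrier ?G = range (word_class R)" and one: "\<one>\<^bsub>?G\<^esub> = word_class R []"
    by (simp_all add: presented_group_def)
  show "\<one>\<^bsub>?G\<^esub> \<in> carrier ?G"
    by (simp add: carrier one)
  show "x \<otimes>\<^bsub>?G\<^esub> y \<in> carrier ?G" if "x \<in> carrier ?G" "y \<in> carrier ?G" for x y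
    using that by (auto simp: carrier presented_group_mult)
  show "x \<otimes>\<^bsub>?G\<^esub> y \<otimes>\<^bsub>?G\<^esub> z = x \<otimes>\<^bsub>?G\<^esub> (y \<otimes>\<^bsub>?G\<^esub> z)"
    if "x \<in> carrier ?G" "y \<in> carrier ?G" "z \<in> carrier ?G" for x y z
    using that by (auto simp: carrier presented_group_mult)
  show "\<one>\<^bsub>?G\<^esub> \<otimes>\<^bsub>?G\<^esub> x = x" if "x \<in> carrier ?G" for x
    using that by (auto simp: carrier one presented_group_mult)
  show "\<exists>y\<in>carrier ?G. y \<otimes>\<^bsub>?G\<^esub> x = \<one>\<^bsub>?G\<^esub>" if "x \<in> carrier ?G" for x
  proof -
    from that obtain u where x: "x = word_class R u" by (auto simp: carrier)
    have "word_class R (rev (map (\<lambda>(a, b). (a, \<not> b)) u)) \<otimes>\<^bsub>?G\<^esub> x = \<one>\<^bsub>?G\<^esub>"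
      by (simp add: x one presented_group_mult word_class_eq_iff word_eq_inverse_left)
    then show ?thesis by (auto simp: carrier)
  qed
qed

datatype dic_gen = GenX | GenY

definition dic_relations :: "nat \<Rightarrow> (dic_gen word \<times> dic_gen word) set" where
  "dic_relations n =
    { (gen_pow GenX (2 * n), []),
      (gen_pow GenY 2, gen_pow GenX n),
      (gen GenY @ gen GenX @ gen_inv GenY, gen_inv GenX) }"

definition dicyclic_group :: "nat \<Rightarrow> dic_gen word set monoid" where
  "dicyclic_group n = presented_group (dic_relations n)"


section \<open>Complex representations and characters\<close>

definition mat_trace :: "complex mat \<Rightarrow> complex" where
  "mat_trace A = (\<Sum>i<dim_row A. A $$ (i, i))"

text \<open>A representation of degree \<open>n\<close> is a homomorphism into the unit group of the matrix ring.\<close>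

definition representation :: "('g, 'b) monoid_scheme \<Rightarrow> nat \<Rightarrow> ('g \<Rightarrow> complex mat) \<Rightarrow> bool" where
  "representation G n \<rho> \<longleftrightarrow> \<rho> \<in> hom G (units_of (ring_mat TYPE(complex) n ()))"

definition irreducible_representation ::
    "('g, 'b) monoid_scheme \<Rightarrow> nat \<Rightarrow> ('g \<Rightarrow> complex mat) \<Rightarrow> bool" where
  "irreducible_representation G n \<rho> \<longleftrightarrow>
    representation G n \<rho> \<and> n > 0 \<and>
    (\<forall>W. VectorSpace.subspace class_ring W (module_vec TYPE(complex) n) \<and>
         (\<forall>g\<in>carrier G. \<forall>w\<in>W. \<rho> g *\<^sub>v w \<in> W) \<longrightarrow>
         W = {0\<^sub>v n} \<or> W = carrier_vec n)"

text \<open>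
  Class functions are functions restricted to the carrier, so that two of them are equal iff they
  agree on the group.
\<close>

definition character_of :: "('g, 'b) monoid_scheme \<Rightarrow> ('g \<Rightarrow> complex mat) \<Rightarrow> 'g \<Rightarrow> complex" where
  "character_of G \<rho> = (\<lambda>g\<in>carrier G. mat_trace (\<rho> g))"

definition irreducible_characters :: "('g, 'b) monoid_scheme \<Rightarrow> ('g \<Rightarrow> complex) set" where
  "irreducible_characters G = {character_of G \<rho> | n \<rho>. irreducible_representation G n \<rho>}"

definition virtual_characters :: "('g, 'b) monoid_scheme \<Rightarrow> ('g \<Rightarrow> complex) set" where
  "virtual_characters G =
    {(\<lambda>g\<in>carrier G. \<Sum>\<chi>\<in>S. of_int (a \<chi>) * \<chi> g) | S (a :: ('g \<Rightarrow> complex) \<Rightarrow> int).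
       finite S \<and> S \<subseteq> irreducible_characters G}"

text \<open>
  The regular representation in the basis \<open>e 0, \<dots>, e (|G| - 1)\<close> of the group algebra: column \<open>j\<close> is
  the image \<open>g \<otimes> e j\<close>.  The choice of the enumeration does not affect the character.
\<close>

definition regular_representation :: "('g, 'b) monoid_scheme \<Rightarrow> 'g \<Rightarrow> complex mat" where
  "regular_representation G g =
    (let e = (SOME e. bij_betw e {..<order G} (carrier G))
     in mat (order G) (order G) (\<lambda>(i, j). if e i = g \<otimes>\<^bsub>G\<^esub> e j then 1 else 0))"

definition regular_character :: "('g, 'b) monoid_scheme \<Rightarrow> 'g \<Rightarrow> complex" where
  "regular_character G = character_of G (regular_representation G)"

lemma regular_character_eq:
  assumes "group G" "finite (carrier G)" "g \<in> carrier G"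
  shows "regular_character G g = (if g = \<one>\<^bsub>G\<^esub> then of_nat (order G) else 0)"
proof -
  interpret group G by fact
  define e where "e = (SOME e. bij_betw e {..<order G} (carrier G))"
  have "\<exists>e. bij_betw e {..<order G} (carrier G)"
    using ex_bij_betw_nat_finite[OF assms(2)] by (simp add: Coset.order_def lessThan_atLeast0)
  then have e: "bij_betw e {..<order G} (carrier G)"
    unfolding e_def by (rule someI_ex)
  have in_carrier: "e i \<in> carrier G" if "i < order G" for i
    using bij_betwE[OF e] that by blast
  have fixed_iff: "e i = g \<otimes>\<^bsub>G\<^esub> e i \<longleftrightarrow> g = \<one>\<^bsub>G\<^esub>" if "i < order G" for i
    by (rule r_cancel_one') (use in_carrier[OF that] assms(3) in auto)
  have "regular_character G g =
      (\<Sum>i<order G. if e i = g \<otimes>\<^bsub>G\<^esub> e i then 1 else 0)"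
    using assms(3)
    by (simp add: regular_character_def character_of_def mat_trace_def regular_representation_def
        Let_def flip: e_def)
  also have "\<dots> = (\<Sum>i<order G. if g = \<one>\<^bsub>G\<^esub> then 1 else 0)"
    by (intro sum.cong if_cong) (simp_all add: fixed_iff)
  finally show ?thesis by simp
qed

definition regular_invertible :: "('g, 'b) monoid_scheme \<Rightarrow> ('g \<Rightarrow> complex) \<Rightarrow> bool" where
  "regular_invertible G \<chi> \<longleftrightarrow>
    (\<exists>\<phi>\<in>virtual_characters G. \<forall>g\<in>carrier G. \<chi> g * \<phi> g = regular_character G g)"


section \<open>The pre-order on virtual characters of positive degree\<close>

text \<open>The degree of a virtual character is an integer, so nothing is lost by taking the real part.\<close>

definition char_degree :: "('g, 'b) monoid_scheme \<Rightarrow> ('g \<Rightarrow> complex) \<Rightarrow> real" where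
  "char_degree G \<chi> = Re (\<chi> \<one>\<^bsub>G\<^esub>)"

definition positive_virtual_characters :: "('g, 'b) monoid_scheme \<Rightarrow> ('g \<Rightarrow> complex) set" where
  "positive_virtual_characters G = {\<chi> \<in> virtual_characters G. char_degree G \<chi> > 0}"

definition char_le :: "('g, 'b) monoid_scheme \<Rightarrow> ('g \<Rightarrow> complex) \<Rightarrow> ('g \<Rightarrow> complex) \<Rightarrow> bool" where
  "char_le G \<chi> \<phi> \<longleftrightarrow>
    char_degree G \<chi> \<le> char_degree G \<phi> \<and> (\<forall>g\<in>carrier G. \<phi> g = 0 \<longrightarrow> \<chi> g = 0)"

definition minimal_character :: "('g, 'b) monoid_scheme \<Rightarrow> ('g \<Rightarrow> complex) \<Rightarrow> bool" where
  "minimal_character G \<chi> \<longleftrightarrow>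
    \<chi> \<in> positive_virtual_characters G \<and>
    (\<forall>\<phi>\<in>positive_virtual_characters G. char_le G \<phi> \<chi> \<longrightarrow> char_le G \<chi> \<phi>)"

end

theory Submission
  imports Defs
begin

text \<open>
  Let \<open>\<zeta>\<close> be a primitive twelfth root of unity.  For \<open>k = 1, \<dots>, 5\<close> the group \<open>Dic\<^sub>6\<close> has an irreducible
  character \<open>\<chi>\<^sub>k\<close> of degree 2, induced from the character \<open>x \<mapsto> \<zeta>\<^sup>k\<close> of the cyclic subgroup \<open>\<langle>x\<rangle>\<close>:
  \<open>\<chi>\<^sub>k (x\<^sup>i) = \<zeta>\<^sup>k\<^sup>i + \<zeta>\<^sup>-\<^sup>k\<^sup>i\<close> and \<open>\<chi>\<^sub>k (x\<^sup>i y) = 0\<close>.  The character in question is \<open>\<chi>\<^sub>1\<close>.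

  It is regular invertible.  Let \<open>\<tau>\<close> be the trivial character and \<open>\<sigma>\<close> the one with \<open>\<sigma> x = 1\<close> and
  \<open>\<sigma> y = -1\<close>, and put \<open>\<chi>\<^sub>0 = \<tau> + \<sigma>\<close> and \<open>\<chi>\<^sub>6 (x\<^sup>i) = 2 (-1)\<^sup>i\<close>, \<open>\<chi>\<^sub>6 (x\<^sup>i y) = 0\<close>.  From
  \<open>\<chi>\<^sub>1 \<chi>\<^sub>k = \<chi>\<^sub>k\<^sub>-\<^sub>1 + \<chi>\<^sub>k\<^sub>+\<^sub>1\<close> one gets that \<open>\<phi> = \<tau> + \<sigma> + \<chi>\<^sub>1 + \<chi>\<^sub>3 + \<chi>\<^sub>5 + 2 \<chi>\<^sub>4\<close> satisfies
  \<open>\<chi>\<^sub>1 \<phi> = \<chi>\<^sub>0 + 2 (\<chi>\<^sub>1 + \<dots> + \<chi>\<^sub>5) + \<chi>\<^sub>6\<close>, which is the regular character.  On \<open>\<langle>x\<rangle>\<close> this amounts to the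
  vanishing of a geometric sum (\<open>twelfth_root_product_eq_0\<close>); on the other coset \<open>\<chi>\<^sub>1\<close> is 0.

  It is not minimal, because \<open>\<chi>\<^sub>3\<close> lies strictly below it.  Both have degree 2, and \<open>u + u\<^sup>-\<^sup>1\<close> divides
  \<open>u\<^sup>3 + u\<^sup>-\<^sup>3\<close>, so \<open>\<chi>\<^sub>3\<close> vanishes wherever \<open>\<chi>\<^sub>1\<close> does; but \<open>\<chi>\<^sub>3 (x) = \<zeta>\<^sup>3 + \<zeta>\<^sup>-\<^sup>3 = 0\<close> while
  \<open>\<chi>\<^sub>1 (x) = \<surd>3 \<noteq> 0\<close> (for \<open>\<zeta> = exp (\<pi> \<i> / 6)\<close>).

  To evaluate these characters on the presented group, one needs its elements.  The relations rewrite
  every word to \<open>x\<^sup>i y\<^sup>e\<close> with \<open>i < 12\<close> and \<open>e \<in> {0, 1}\<close> (\<open>dicyclic_carrier\<close>).  Conversely, von Dyck's theorem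
  (\<open>presented_group_hom\<close>) produces the matrix representations, and the one belonging to \<open>\<zeta>\<close> separates
  these 24 elements (\<open>inj_on_dic_elem\<close>).  All of this works for \<open>Dic\<^sub>n\<close> with \<open>n > 0\<close>.
\<close>

section \<open>Homomorphisms out of a presented group\<close>

primrec word_eval :: "('h, 'b) monoid_scheme \<Rightarrow> ('a \<Rightarrow> 'h) \<Rightarrow> 'a word \<Rightarrow> 'h" where
  "word_eval H f [] = \<one>\<^bsub>H\<^esub>"
| "word_eval H f (l # w) =
    (if snd l then f (fst l) else inv\<^bsub>H\<^esub> (f (fst l))) \<otimes>\<^bsub>H\<^esub> word_eval H f w"

context group
begin

lemma word_eval_closed:
  assumes "\<And>a. f a \<in> carrier G"
  shows "word_eval G f w \<in> carrier G"
  using assms by (induction w) auto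

lemma word_eval_append:
  assumes "\<And>a. f a \<in> carrier G"
  shows "word_eval G f (u @ v) = word_eval G f u \<otimes> word_eval G f v"
  using assms by (induction u) (auto simp: m_assoc word_eval_closed)

lemma word_eval_cong:
  assumes f: "\<And>a. f a \<in> carrier G"
    and R: "\<And>u v. (u, v) \<in> R \<Longrightarrow> word_eval G f u = word_eval G f v"
    and "word_eq R u v"
  shows "word_eval G f u = word_eval G f v"
  using \<open>word_eq R u v\<close>
proof induction
  case (cancel a b)
  then show ?case using f by (cases b) auto
qed (auto simp: R f word_eval_append)

text \<open>
  Von Dyck's theorem.  The map is evaluation of any representative of a class; it is well defined by
  \<open>word_eval_cong\<close>.
\<close>

lemma presented_group_hom:
  assumes f: "\<And>a. f a \<in> carrier G"
    and R: "\<And>u v. (u, v) \<in> R \<Longrightarrow> word_eval G f u = word_eval G f v"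
  obtains h where "h \<in> hom (presented_group R) G" "\<And>a. h (word_class R (gen a)) = f a"
proof
  define h where "h A = word_eval G f (SOME w. w \<in> A)" for A
  have h: "h (word_class R w) = word_eval G f w" for w
  proof -
    have "w \<in> word_class R w"
      by (simp add: word_class_def word_eq.refl)
    then have "(SOME v. v \<in> word_class R w) \<in> word_class R w"
      by (rule someI)
    then show ?thesis
      unfolding h_def word_class_def
      using word_eval_cong[OF f R] by (metis mem_Collect_eq)
  qed
  show "h \<in> hom (presented_group R) G"
  proof (rule homI)
    fix A B
    assume "A \<in> carrier (presented_group R)" "B \<in> carrier (presented_group R)"
    then obtain u v where "A = word_class R u" "B = word_class R v"
      by (auto simp: presented_group_def)
    then show "h (A \<otimes>\<^bsub>presented_group R\<^esub> B) = h A \<otimes> h B"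
      by (simp add: presented_group_mult h word_eval_append f)
  qed (auto simp: presented_group_def h word_eval_closed f)
  show "h (word_class R (gen a)) = f a" for a
    by (simp add: h f)
qed

end

lemma word_class_closed: "word_class R w \<in> carrier (presented_group R)"
  by (simp add: presented_group_def)

lemma word_class_gen_inv:
  "word_class R (gen_inv a) = inv\<^bsub>presented_group R\<^esub> (word_class R (gen a))"
proof -
  interpret group "presented_group R" by (rule group_presented_group)
  have "word_class R (gen_inv a) \<otimes>\<^bsub>presented_group R\<^esub> word_class R (gen a) = word_class R []"
    using word_eq.cancel[of R a False] by (simp add: presented_group_mult word_class_eq_iff)
  then show ?thesis
    using inv_equality by (simp add: word_class_closed presented_group_def)
qed

lemma word_class_gen_pow:
  "word_class R (gen_pow a k) = word_class R (gen a) [^]\<^bsub>presented_group R\<^esub> k"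
proof -
  interpret group "presented_group R" by (rule group_presented_group)
  show ?thesis
  proof (induction k)
    case 0
    show ?case by (simp add: gen_pow_def) (simp add: presented_group_def)
  next
    case (Suc k)
    have "word_class R (gen_pow a (Suc k)) = word_class R (gen_pow a k @ gen a)"
      by (simp add: gen_pow_def replicate_append_same)
    then show ?case
      by (simp add: Suc flip: presented_group_mult)
  qed
qed


section \<open>Normal forms in the dicyclic group\<close>

text \<open>
  Two elements of an arbitrary group that satisfy the relations of \<open>Dic\<^sub>n\<close>.  The set \<open>elems\<close> below turns
  out to be closed under left multiplication by the generators and their inverses, so that it contains
  every value of a word in \<open>x\<close> and \<open>y\<close>.
\<close>

locale dicyclic_pair = group +
  fixes n :: nat and x y
  assumes n_pos: "n > 0"
    and x_closed [simp]: "x \<in> carrier G" and y_closed [simp]: "y \<in> carrier G"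
    and x_pow: "x [^] (2 * n) = \<one>"
    and y_sq: "y \<otimes> y = x [^] n"
    and y_x: "y \<otimes> x \<otimes> inv y = inv x"
begin

definition elem :: "nat \<Rightarrow> bool \<Rightarrow> 'a" where
  "elem i e = x [^] i \<otimes> (if e then y else \<one>)"

lemma elem_closed [simp]: "elem i e \<in> carrier G"
  by (simp add: elem_def)

text \<open>
  Both inverses are words in \<open>x\<close> and \<open>y\<close> with positive exponents, so that closure under the generators
  already implies closure under their inverses.
\<close>

lemma inv_x: "inv x = x [^] (2 * n - 1)"
proof -
  have "x [^] (2 * n - 1) \<otimes> x = \<one>"
    using x_pow n_pos by (cases n) auto
  then show ?thesis by (simp add: inv_equality)
qed

lemma inv_y: "inv y = x [^] n \<otimes> y"
proof -
  have "x [^] n \<otimes> y \<otimes> y = x [^] (2 * n)"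
    by (simp add: m_assoc y_sq nat_pow_mult mult_2)
  then show ?thesis by (simp add: inv_equality x_pow)
qed

lemma y_x_pow: "y \<otimes> x [^] i = x [^] ((2 * n - 1) * i) \<otimes> y" for i :: nat
proof (induction i)
  case 0
  show ?case by simp
next
  case (Suc i)
  have yx: "y \<otimes> x = x [^] (2 * n - 1) \<otimes> y"
    using y_x by (simp add: inv_solve_right' inv_x)
  have "y \<otimes> x [^] Suc i = x [^] ((2 * n - 1) * i) \<otimes> (y \<otimes> x)"
    using Suc by (simp add: m_assoc [symmetric])
  also have "\<dots> = x [^] ((2 * n - 1) * Suc i) \<otimes> y"
    by (simp add: yx nat_pow_mult add.commute flip: m_assoc)
  finally show ?case .
qed

lemma x_elem: "x \<otimes> elem i e = elem (Suc i) e"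
  using nat_pow_Suc2[OF x_closed, of i] by (simp add: elem_def m_assoc [symmetric] del: nat_pow_Suc)

lemma y_elem: "y \<otimes> elem i e = elem ((2 * n - 1) * i + (if e then n else 0)) (\<not> e)"
proof -
  have "y \<otimes> elem i e = x [^] ((2 * n - 1) * i) \<otimes> (y \<otimes> (if e then y else \<one>))"
    by (simp add: elem_def y_x_pow flip: m_assoc)
  then show ?thesis
    by (simp add: elem_def y_sq nat_pow_mult)
qed

lemma x_pow_mod: "x [^] (i mod (2 * n)) = x [^] i" for i :: nat
proof -
  have "x [^] i = x [^] (2 * n * (i div (2 * n)) + i mod (2 * n))"
    by simp
  also have "\<dots> = (x [^] (2 * n)) [^] (i div (2 * n)) \<otimes> x [^] (i mod (2 * n))"
    by (simp only: nat_pow_mult nat_pow_pow x_closed)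
  finally show ?thesis by (simp add: x_pow)
qed

lemma elem_mod: "elem (i mod (2 * n)) e = elem i e"
  by (simp add: elem_def x_pow_mod)

definition elems :: "'a set" where
  "elems = (\<lambda>(i, e). elem i e) ` ({..<2 * n} \<times> UNIV)"

lemma elem_in_elems: "elem i e \<in> elems"
proof -
  have "(i mod (2 * n), e) \<in> {..<2 * n} \<times> UNIV"
    using n_pos by simp
  then show ?thesis
    unfolding elems_def by (metis (no_types, lifting) case_prod_conv elem_mod image_eqI)
qed

lemma elems_closed_x: "g \<in> elems \<Longrightarrow> x \<otimes> g \<in> elems"
  by (auto simp: elems_def x_elem intro: elem_in_elems[unfolded elems_def])

lemma elems_closed_y: "g \<in> elems \<Longrightarrow> y \<otimes> g \<in> elems"
  unfolding elems_def using elem_in_elems[unfolded elems_def] y_elem by auto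

lemma elems_subset: "elems \<subseteq> carrier G"
  by (auto simp: elems_def)

lemma elems_closed_x_pow: "g \<in> elems \<Longrightarrow> x [^] i \<otimes> g \<in> elems" for i :: nat
proof (induction i)
  case 0
  then show ?case using elems_subset by auto
next
  case (Suc i)
  then have "x \<otimes> (x [^] i \<otimes> g) \<in> elems" by (simp add: elems_closed_x)
  moreover have "g \<in> carrier G" using Suc.prems elems_subset by blast
  ultimately show ?case
    using nat_pow_Suc2[OF x_closed, of i] by (simp add: m_assoc del: nat_pow_Suc)
qed

lemma elems_closed_inv_y: "g \<in> elems \<Longrightarrow> inv y \<otimes> g \<in> elems"
  using elems_subset elems_closed_y elems_closed_x_pow[of "y \<otimes> g" n]
  by (auto simp: inv_y m_assoc subset_iff)

lemma elems_closed_inv_x: "g \<in> elems \<Longrightarrow> inv x \<otimes> g \<in> elems"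
  by (simp add: inv_x elems_closed_x_pow)

end

abbreviation dic_x :: "nat \<Rightarrow> dic_gen word set" where
  "dic_x n \<equiv> word_class (dic_relations n) (gen GenX)"

abbreviation dic_y :: "nat \<Rightarrow> dic_gen word set" where
  "dic_y n \<equiv> word_class (dic_relations n) (gen GenY)"

lemma dicyclic_pair_generators:
  assumes "n > 0"
  shows "dicyclic_pair (dicyclic_group n) n (dic_x n) (dic_y n)"
proof -
  let ?R = "dic_relations n"
  interpret group "presented_group ?R" by (rule group_presented_group)
  have rel: "word_class ?R u = word_class ?R v" if "(u, v) \<in> ?R" for u v
    using that by (simp add: word_class_eq_iff word_eq.rel)
  have "word_class ?R (gen_pow GenX (2 * n)) = word_class ?R []"
    by (rule rel) (simp add: dic_relations_def)
  then have x_pow: "dic_x n [^]\<^bsub>presented_group ?R\<^esub> (2 * n) = \<one>\<^bsub>presented_group ?R\<^esub>"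
    by (simp only: word_class_gen_pow) (simp add: presented_group_def)
  have "word_class ?R (gen GenY @ gen GenY) = word_class ?R (gen_pow GenX n)"
    by (rule rel) (simp add: dic_relations_def gen_pow_def numeral_2_eq_2)
  then have y_sq: "dic_y n \<otimes>\<^bsub>presented_group ?R\<^esub> dic_y n = dic_x n [^]\<^bsub>presented_group ?R\<^esub> n"
    by (simp only: word_class_gen_pow presented_group_mult)
  have "word_class ?R ((gen GenY @ gen GenX) @ gen_inv GenY) = word_class ?R (gen_inv GenX)"
    by (rule rel) (simp add: dic_relations_def)
  then have y_x: "dic_y n \<otimes>\<^bsub>presented_group ?R\<^esub> dic_x n \<otimes>\<^bsub>presented_group ?R\<^esub>
      inv\<^bsub>presented_group ?R\<^esub> (dic_y n) = inv\<^bsub>presented_group ?R\<^esub> (dic_x n)"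
    by (simp only: word_class_gen_inv flip: presented_group_mult)
  show ?thesis
    unfolding dicyclic_group_def using assms x_pow y_sq y_x
    by unfold_locales (simp_all add: word_class_closed)
qed

lemma dicyclic_carrier:
  assumes "n > 0"
  shows "carrier (dicyclic_group n) = dicyclic_pair.elems (dicyclic_group n) n (dic_x n) (dic_y n)"
proof -
  let ?R = "dic_relations n"
  interpret dicyclic_pair "dicyclic_group n" n "dic_x n" "dic_y n"
    by (rule dicyclic_pair_generators) fact
  have "word_class ?R w \<in> elems" for w
  proof (induction w)
    case Nil
    have "word_class ?R [] = elem 0 False"
      by (simp add: elem_def) (simp add: dicyclic_group_def presented_group_def)
    then show ?case by (simp add: elem_in_elems)
  next
    case (Cons l w)
    obtain a b where l: "l = (a, b)" by (cases l)
    have eq: "word_class ?R ((a, b) # w) = word_class ?R [(a, b)] \<otimes>\<^bsub>dicyclic_group n\<^esub> word_class ?R w"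
      by (simp add: dicyclic_group_def presented_group_mult)
    have inv_gen: "word_class ?R (gen_inv c) = inv\<^bsub>dicyclic_group n\<^esub> (word_class ?R (gen c))" for c
      by (simp add: dicyclic_group_def word_class_gen_inv)
    show ?case
      unfolding l eq using Cons
      by (cases a; cases b)
        (simp_all add: inv_gen elems_closed_x elems_closed_y elems_closed_inv_x elems_closed_inv_y)
  qed
  then show ?thesis
    using elems_subset by (auto simp: dicyclic_group_def presented_group_def)
qed


section \<open>Representations of the dicyclic group\<close>

lemma dicyclic_group_hom:
  assumes H: "group H" and a: "a \<in> carrier H" and b: "b \<in> carrier H"
    and "a [^]\<^bsub>H\<^esub> (2 * n) = \<one>\<^bsub>H\<^esub>" and "b \<otimes>\<^bsub>H\<^esub> b = a [^]\<^bsub>H\<^esub> n"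
    and "b \<otimes>\<^bsub>H\<^esub> a = inv\<^bsub>H\<^esub> a \<otimes>\<^bsub>H\<^esub> b"
  obtains h where "h \<in> hom (dicyclic_group n) H" "h (dic_x n) = a" "h (dic_y n) = b"
proof -
  interpret group H by fact
  define f where "f c = (case c of GenX \<Rightarrow> a | GenY \<Rightarrow> b)" for c
  have f: "f c \<in> carrier H" for c
    using a b by (simp add: f_def split: dic_gen.split)
  have pow: "word_eval H f (gen_pow c k) = f c [^]\<^bsub>H\<^esub> k" for c k
  proof (induction k)
    case (Suc k)
    then have "word_eval H f (gen_pow c (Suc k)) = f c \<otimes>\<^bsub>H\<^esub> f c [^]\<^bsub>H\<^esub> k"
      by (simp add: gen_pow_def)
    then show ?case using nat_pow_Suc2[OF f] by simp
  qed (simp add: gen_pow_def)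
  have "b \<otimes>\<^bsub>H\<^esub> (a \<otimes>\<^bsub>H\<^esub> inv\<^bsub>H\<^esub> b) = inv\<^bsub>H\<^esub> a"
    using assms by (simp add: inv_solve_right' flip: m_assoc)
  then have "word_eval H f u = word_eval H f v" if "(u, v) \<in> dic_relations n" for u v
    using that assms
    by (auto simp: dic_relations_def pow f_def numeral_2_eq_2)
  from presented_group_hom[OF f this] show thesis
    using that unfolding dicyclic_group_def f_def by (metis dic_gen.simps(3,4))
qed

definition mat2 :: "'a \<Rightarrow> 'a \<Rightarrow> 'a \<Rightarrow> 'a \<Rightarrow> 'a mat" where
  "mat2 a b c d =
    mat 2 2 (\<lambda>(i, j). if i = 0 then if j = 0 then a else b else if j = 0 then c else d)"

lemma mat2_carrier [simp]: "mat2 a b c d \<in> carrier_mat 2 2"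
  by (simp add: mat2_def)

lemma mat2_eq_iff: "mat2 a b c d = mat2 a' b' c' d' \<longleftrightarrow> a = a' \<and> b = b' \<and> c = c' \<and> d = d'"
proof
  assume eq: "mat2 a b c d = mat2 a' b' c' d'"
  have "mat2 a b c d $$ (i, j) = mat2 a' b' c' d' $$ (i, j)" for i j
    by (simp add: eq)
  from this[of 0 0] this[of 0 1] this[of 1 0] this[of 1 1]
  show "a = a' \<and> b = b' \<and> c = c' \<and> d = d'"
    by (simp add: mat2_def)
qed simp

lemma one_mat2: "1\<^sub>m 2 = mat2 1 0 0 1"
  by (rule eq_matI) (auto simp: mat2_def)

lemma mat2_mult:
  fixes a :: "'a :: semiring_0"
  shows "mat2 a b c d * mat2 a' b' c' d' =
    mat2 (a * a' + b * c') (a * b' + b * d') (c * a' + d * c') (c * b' + d * d')"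
  by (rule eq_matI) (auto simp: mat2_def scalar_prod_def numeral_2_eq_2)

lemma mat_trace_mat2: "mat_trace (mat2 a b c d) = a + d"
  by (simp add: mat_trace_def mat2_def numeral_2_eq_2)

abbreviation GL :: "nat \<Rightarrow> complex mat monoid" where
  "GL m \<equiv> units_of (ring_mat TYPE(complex) m ())"

lemma group_GL: "group (GL m)"
  by (intro monoid.units_group ring.is_monoid ring_mat)

lemma GL_I:
  assumes "A \<in> carrier_mat m m" "B \<in> carrier_mat m m" "A * B = 1\<^sub>m m" "B * A = 1\<^sub>m m"
  shows "A \<in> carrier (GL m)" "inv\<^bsub>GL m\<^esub> A = B"
proof -
  interpret group "GL m" by (rule group_GL)
  have *: "A \<in> carrier (GL m)" "B \<in> carrier (GL m)"
    using assms by (auto simp: units_of_carrier Units_def ring_mat_simps)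
  then show "A \<in> carrier (GL m)" by simp
  show "inv\<^bsub>GL m\<^esub> A = B"
    using * assms by (intro inv_equality) (simp_all add: units_of_mult units_of_one ring_mat_simps)
qed

lemma GL_mult: "A \<otimes>\<^bsub>GL m\<^esub> B = A * B"
  by (simp add: units_of_mult ring_mat_simps)

lemma GL_one: "\<one>\<^bsub>GL m\<^esub> = 1\<^sub>m m"
  by (simp add: units_of_one ring_mat_simps)

lemma diag_pow: "mat2 w 0 0 (inverse w) [^]\<^bsub>GL 2\<^esub> i = mat2 (w ^ i) 0 0 (inverse w ^ i)" for i :: nat
proof (induction i)
  case (Suc i)
  then show ?case
    by (simp add: GL_mult mat2_mult mult.commute)
qed (simp add: GL_one one_mat2)

lemma inverse_root_pow:
  fixes w :: complex
  assumes "w ^ (2 * n) = 1"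
  shows "inverse w ^ n = w ^ n"
proof -
  have "w ^ n * w ^ n = 1"
    using assms by (simp add: mult_2 power_add)
  then show ?thesis
    by (simp add: power_inverse inverse_unique)
qed

text \<open>
  The representation induced from the character \<open>x \<mapsto> w\<close> of \<open>\<langle>x\<rangle>\<close>.  The entry \<open>w\<^sup>n = \<plusminus>1\<close> is what makes the
  square of the image of \<open>y\<close> equal to the image of \<open>x\<^sup>n\<close>.
\<close>

lemma dicyclic_representation:
  assumes n: "n > 0" and w: "w ^ (2 * n) = 1"
  obtains \<rho> where "representation (dicyclic_group n) 2 \<rho>"
    "\<rho> (dic_x n) = mat2 w 0 0 (inverse w)" "\<rho> (dic_y n) = mat2 0 (w ^ n) 1 0"
proof -
  have w0: "w \<noteq> 0"
    using n w by (auto simp: power_0_left)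
  have ww: "w ^ n * w ^ n = 1"
    using w by (simp add: mult_2 power_add)
  have a: "mat2 w 0 0 (inverse w) \<in> carrier (GL 2)"
    "inv\<^bsub>GL 2\<^esub> (mat2 w 0 0 (inverse w)) = mat2 (inverse w) 0 0 w"
    using w0 by (intro GL_I[of _ 2 "mat2 (inverse w) 0 0 w"]; simp add: mat2_mult one_mat2)+
  have b: "mat2 0 (w ^ n) 1 0 \<in> carrier (GL 2)"
    using ww by (intro GL_I(1)[of _ _ "mat2 0 1 (w ^ n) 0"]) (simp_all add: mat2_mult one_mat2)
  show thesis
  proof (rule dicyclic_group_hom[OF group_GL a(1) b])
    show "mat2 w 0 0 (inverse w) [^]\<^bsub>GL 2\<^esub> (2 * n) = \<one>\<^bsub>GL 2\<^esub>"
      by (simp add: diag_pow GL_one one_mat2 w power_inverse)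
    show "mat2 0 (w ^ n) 1 0 \<otimes>\<^bsub>GL 2\<^esub> mat2 0 (w ^ n) 1 0 = mat2 w 0 0 (inverse w) [^]\<^bsub>GL 2\<^esub> n"
      by (simp add: diag_pow GL_mult mat2_mult inverse_root_pow[OF w])
    show "mat2 0 (w ^ n) 1 0 \<otimes>\<^bsub>GL 2\<^esub> mat2 w 0 0 (inverse w) =
        inv\<^bsub>GL 2\<^esub> (mat2 w 0 0 (inverse w)) \<otimes>\<^bsub>GL 2\<^esub> mat2 0 (w ^ n) 1 0"
      unfolding a(2) by (simp add: GL_mult mat2_mult mult.commute)
  qed (use that in \<open>simp add: representation_def\<close>)
qed


abbreviation dic_elem :: "nat \<Rightarrow> nat \<Rightarrow> bool \<Rightarrow> dic_gen word set" where
  "dic_elem n \<equiv> dicyclic_pair.elem (dicyclic_group n) (dic_x n) (dic_y n)"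

lemma group_dicyclic_group: "group (dicyclic_group n)"
  by (simp add: dicyclic_group_def group_presented_group)

lemma representation_dic_elem:
  assumes n: "n > 0" and \<rho>: "representation (dicyclic_group n) m \<rho>"
  shows "\<rho> (dic_elem n i e) =
    \<rho> (dic_x n) [^]\<^bsub>GL m\<^esub> i \<otimes>\<^bsub>GL m\<^esub> (if e then \<rho> (dic_y n) else 1\<^sub>m m)"
proof -
  interpret dicyclic_pair "dicyclic_group n" n "dic_x n" "dic_y n"
    by (rule dicyclic_pair_generators) fact
  interpret group_hom "dicyclic_group n" "GL m" \<rho>
    using \<rho> group_axioms group_GL
    by (intro group_hom.intro group_hom_axioms.intro) (simp_all add: representation_def)
  show ?thesis
    by (simp add: elem_def hom_nat_pow GL_one)
qed

lemma dicyclic_representation_elem: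
  assumes "n > 0" "representation (dicyclic_group n) 2 \<rho>"
    and "\<rho> (dic_x n) = mat2 w 0 0 (inverse w)" "\<rho> (dic_y n) = mat2 0 (w ^ n) 1 0"
  shows "\<rho> (dic_elem n i e) =
    (if e then mat2 0 (w ^ (i + n)) (inverse w ^ i) 0 else mat2 (w ^ i) 0 0 (inverse w ^ i))"
  using assms
  by (simp add: representation_dic_elem diag_pow GL_mult mat2_mult one_mat2 power_add)

lemma dic_elem_surj:
  assumes "n > 0" "g \<in> carrier (dicyclic_group n)"
  obtains i e where "i < 2 * n" "g = dic_elem n i e"
proof -
  interpret dicyclic_pair "dicyclic_group n" n "dic_x n" "dic_y n"
    by (rule dicyclic_pair_generators) fact
  show thesis
    using assms that by (auto simp: dicyclic_carrier elems_def)
qed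

lemma dic_elem_closed: "n > 0 \<Longrightarrow> dic_elem n i e \<in> carrier (dicyclic_group n)"
  by (rule dicyclic_pair.elem_closed[OF dicyclic_pair_generators])

lemma dic_elem_0: "n > 0 \<Longrightarrow> dic_elem n 0 False = \<one>\<^bsub>dicyclic_group n\<^esub>"
proof -
  assume "n > 0"
  then interpret dicyclic_pair "dicyclic_group n" n "dic_x n" "dic_y n"
    by (rule dicyclic_pair_generators)
  show ?thesis by (simp add: elem_def)
qed

lemma primitive_root:
  assumes "m > 0"
  obtains z :: complex where "z ^ m = 1" "inj_on (\<lambda>i. z ^ i) {..<m}"
proof
  let ?z = "cis (2 * pi / m)"
  have pow: "?z ^ k = cis (2 * pi * real k / real m)" for k
    by (simp add: DeMoivre mult.commute)
  show "?z ^ m = 1"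
    using assms by (simp add: pow)
  show "inj_on (\<lambda>i. ?z ^ i) {..<m}"
    unfolding pow by (rule bij_betw_imp_inj_on[OF bij_betw_roots_unity[OF assms]])
qed

text \<open>
  For a primitive root of unity the representation is faithful: powers of \<open>x\<close> go to diagonal matrices
  with distinct corner entries, and the other elements go to antidiagonal matrices.
\<close>

lemma inj_on_dic_elem:
  assumes "n > 0"
  shows "inj_on (\<lambda>(i, e). dic_elem n i e) ({..<2 * n} \<times> UNIV)"
proof -
  obtain z :: complex where z: "z ^ (2 * n) = 1" "inj_on (\<lambda>i. z ^ i) {..<2 * n}"
    using primitive_root[of "2 * n"] assms by auto
  obtain \<rho> where \<rho>: "representation (dicyclic_group n) 2 \<rho>"
    "\<rho> (dic_x n) = mat2 z 0 0 (inverse z)" "\<rho> (dic_y n) = mat2 0 (z ^ n) 1 0"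
    using dicyclic_representation[OF assms z(1)] by blast
  have z0: "z \<noteq> 0"
    using z(1) assms by (auto simp: power_0_left)
  have "i = j \<and> e = e'"
    if "i < 2 * n" "j < 2 * n" and eq: "dic_elem n i e = dic_elem n j e'" for i j e e'
  proof -
    have "\<rho> (dic_elem n i e) = \<rho> (dic_elem n j e')"
      by (simp add: eq)
    then have "e = e' \<and> z ^ i = z ^ j"
      using z0 by (auto simp: dicyclic_representation_elem[OF assms \<rho>] mat2_eq_iff power_add
          split: if_splits)
    then show ?thesis
      using that z(2) by (auto dest: inj_onD)
  qed
  then show ?thesis
    by (auto simp: inj_on_def)
qed

theorem order_dicyclic_group:
  assumes "n > 0"
  shows "order (dicyclic_group n) = 4 * n"
proof -
  interpret dicyclic_pair "dicyclic_group n" n "dic_x n" "dic_y n"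
    by (rule dicyclic_pair_generators) fact
  have "card (carrier (dicyclic_group n)) = card ({..<2 * n} \<times> (UNIV :: bool set))"
    unfolding dicyclic_carrier[OF assms] elems_def by (rule card_image[OF inj_on_dic_elem]) fact
  then show ?thesis
    by (simp add: Coset.order_def card_cartesian_product)
qed


section \<open>Irreducible characters of the dicyclic group\<close>

lemma irreducible_representation_1:
  assumes "representation G 1 \<rho>"
  shows "irreducible_representation G 1 \<rho>"
proof -
  have "W = carrier_vec 1"
    if W: "VectorSpace.subspace class_ring W (module_vec TYPE(complex) 1)" and "W \<noteq> {0\<^sub>v 1}" for W
  proof -
    from W have sub: "W \<subseteq> carrier_vec 1" and zero: "0\<^sub>v 1 \<in> W"
      and smult: "\<And>c v. v \<in> W \<Longrightarrow> c \<cdot>\<^sub>v v \<in> W"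
      by (auto simp: VectorSpace.subspace_def LinearCombinations.submodule_def module_vec_simps)
    obtain v where v: "v \<in> W" "v \<noteq> 0\<^sub>v 1"
      using zero \<open>W \<noteq> {0\<^sub>v 1}\<close> by blast
    then have v0: "v $ 0 \<noteq> 0"
      using sub by (auto simp: vec_eq_iff)
    have "u \<in> W" if "u \<in> carrier_vec 1" for u
    proof -
      have "u = (u $ 0 / v $ 0) \<cdot>\<^sub>v v"
        using that v v0 sub by (intro eq_vecI) auto
      then show ?thesis using smult[OF v(1)] by metis
    qed
    then show ?thesis using sub by blast
  qed
  then show ?thesis
    using assms by (auto simp: irreducible_representation_def)
qed

definition vec2 :: "'a \<Rightarrow> 'a \<Rightarrow> 'a vec" where
  "vec2 p q = vec 2 (\<lambda>i. if i = 0 then p else q)"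

lemma vec2_cases:
  assumes "v \<in> carrier_vec 2"
  obtains p q where "v = vec2 p q"
proof
  show "v = vec2 (v $ 0) (v $ 1)"
    using assms by (intro eq_vecI) (auto simp: vec2_def less_2_cases_iff)
qed

lemma mat2_mult_vec2:
  fixes a :: "'a :: semiring_0"
  shows "mat2 a b c d *\<^sub>v vec2 p q = vec2 (a * p + b * q) (c * p + d * q)"
  by (intro eq_vecI) (auto simp: mat2_def vec2_def scalar_prod_def numeral_2_eq_2)

text \<open>
  Since \<open>a \<noteq> d\<close>, subtracting \<open>d v\<close> from the image of \<open>v\<close> under the diagonal matrix isolates the first
  coordinate of \<open>v\<close>; the antidiagonal matrix interchanges the two coordinate axes.  Hence an invariant
  subspace with a nonzero vector contains both axes.
\<close>

lemma irreducible_representation_diag_antidiag: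
  assumes \<rho>: "representation G 2 \<rho>" and g: "g \<in> carrier G" and h: "h \<in> carrier G"
    and \<rho>g: "\<rho> g = mat2 a 0 0 d" and \<rho>h: "\<rho> h = mat2 0 b c 0"
    and "a \<noteq> d" "b \<noteq> 0" "c \<noteq> 0"
  shows "irreducible_representation G 2 \<rho>"
proof -
  have "W = carrier_vec 2"
    if W: "VectorSpace.subspace class_ring W (module_vec TYPE(complex) 2)" and "W \<noteq> {0\<^sub>v 2}"
      and inv: "\<And>g w. g \<in> carrier G \<Longrightarrow> w \<in> W \<Longrightarrow> \<rho> g *\<^sub>v w \<in> W" for W
  proof -
    from W have sub: "W \<subseteq> carrier_vec 2" and zero: "0\<^sub>v 2 \<in> W"
      and add: "\<And>v w. v \<in> W \<Longrightarrow> w \<in> W \<Longrightarrow> v + w \<in> W"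
      and smult: "\<And>c v. v \<in> W \<Longrightarrow> c \<cdot>\<^sub>v v \<in> W"
      by (auto simp: VectorSpace.subspace_def LinearCombinations.submodule_def module_vec_simps)
    have add2: "vec2 (p + p') (q + q') \<in> W" if "vec2 p q \<in> W" "vec2 p' q' \<in> W" for p q p' q'
    proof -
      have "vec2 (p + p') (q + q') = vec2 p q + vec2 p' q'"
        by (intro eq_vecI) (auto simp: vec2_def)
      then show ?thesis using add[OF that] by metis
    qed
    have smult2: "vec2 (k * p) (k * q) \<in> W" if "vec2 p q \<in> W" for k p q
    proof -
      have "vec2 (k * p) (k * q) = k \<cdot>\<^sub>v vec2 p q"
        by (intro eq_vecI) (auto simp: vec2_def)
      then show ?thesis using smult[OF that] by metis
    qed
    have g2: "vec2 (a * p) (d * q) \<in> W" if "vec2 p q \<in> W" for p q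
      using inv[OF g that] by (simp add: \<rho>g mat2_mult_vec2)
    have h2: "vec2 (b * q) (c * p) \<in> W" if "vec2 p q \<in> W" for p q
      using inv[OF h that] by (simp add: \<rho>h mat2_mult_vec2)
    obtain v where v: "v \<in> W" "v \<noteq> 0\<^sub>v 2"
      using zero \<open>W \<noteq> {0\<^sub>v 2}\<close> by blast
    obtain p q where pq: "v = vec2 p q"
      using v sub vec2_cases by blast
    have "p \<noteq> 0 \<or> q \<noteq> 0"
      using v(2) by (auto simp: pq vec2_def vec_eq_iff)
    have scaled: "vec2 1 0 \<in> W" if "vec2 r 0 \<in> W" "r \<noteq> 0" for r
      using smult2[OF that(1), of "inverse r"] that(2) by simp
    have e1: "vec2 1 0 \<in> W"
    proof (cases "p = 0")
      case True
      then have "vec2 (b * q) 0 \<in> W" "b * q \<noteq> 0"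
        using h2[of p q] v(1) \<open>p \<noteq> 0 \<or> q \<noteq> 0\<close> \<open>b \<noteq> 0\<close> by (simp_all add: pq)
      then show ?thesis by (rule scaled)
    next
      case False
      have "vec2 (a * p + - d * p) (d * q + - d * q) \<in> W"
        using v(1) by (intro add2 g2 smult2) (simp_all add: pq)
      then have "vec2 ((a - d) * p) 0 \<in> W"
        by (simp add: algebra_simps)
      then show ?thesis
        by (rule scaled) (use False \<open>a \<noteq> d\<close> in simp)
    qed
    have "vec2 0 1 \<in> W"
      using smult2[OF h2[OF e1], of "inverse c"] \<open>c \<noteq> 0\<close> by simp
    then have "vec2 r s \<in> W" for r s
      using add2[OF smult2[OF e1, of r] smult2[of 0 1 s]] by simp
    then show ?thesis
      using sub vec2_cases by (metis subsetI subset_antisym)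
  qed
  then show ?thesis
    using \<rho> by (auto simp: irreducible_representation_def)
qed

lemma dicyclic_character_2:
  assumes n: "n > 0" and w: "w ^ (2 * n) = 1" and "w\<^sup>2 \<noteq> 1"
  obtains \<chi> where "\<chi> \<in> irreducible_characters (dicyclic_group n)"
    "\<And>i e. \<chi> (dic_elem n i e) = (if e then 0 else w ^ i + inverse w ^ i)"
proof -
  have w0: "w \<noteq> 0"
    using n w by (auto simp: power_0_left)
  obtain \<rho> where \<rho>: "representation (dicyclic_group n) 2 \<rho>"
    "\<rho> (dic_x n) = mat2 w 0 0 (inverse w)" "\<rho> (dic_y n) = mat2 0 (w ^ n) 1 0"
    using dicyclic_representation[OF n w] by blast
  have "w \<noteq> inverse w"
    using \<open>w\<^sup>2 \<noteq> 1\<close> w0 by (auto simp: power2_eq_square field_simps)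
  then have "irreducible_representation (dicyclic_group n) 2 \<rho>"
    using w0 by (intro irreducible_representation_diag_antidiag[OF \<rho>(1) _ _ \<rho>(2,3)])
      (simp_all add: dicyclic_group_def word_class_closed)
  moreover have "character_of (dicyclic_group n) \<rho> (dic_elem n i e) =
      (if e then 0 else w ^ i + inverse w ^ i)" for i e
    using n by (simp add: character_of_def dic_elem_closed dicyclic_representation_elem[OF n \<rho>]
        mat_trace_mat2)
  ultimately show thesis
    using that unfolding irreducible_characters_def by blast
qed

lemma dicyclic_character_1:
  assumes n: "n > 0" and s: "s\<^sup>2 = 1"
  obtains \<chi> where "\<chi> \<in> irreducible_characters (dicyclic_group n)"
    "\<And>i e. \<chi> (dic_elem n i e) = (if e then s else 1)"
proof -
  interpret group "GL 1" by (rule group_GL)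
  let ?S = "s \<cdot>\<^sub>m 1\<^sub>m 1"
  have one_pow: "1\<^sub>m 1 [^]\<^bsub>GL 1\<^esub> k = 1\<^sub>m 1" for k :: nat
    using nat_pow_one[of k] by (simp only: GL_one)
  have one_inv: "inv\<^bsub>GL 1\<^esub> (1\<^sub>m 1) = 1\<^sub>m 1"
    using inv_one by (simp only: GL_one)
  have S: "?S * ?S = 1\<^sub>m 1"
    using s by (intro eq_matI) (auto simp: power2_eq_square scalar_prod_def)
  then have b: "?S \<in> carrier (GL 1)"
    by (intro GL_I(1)[of _ _ ?S]) simp_all
  obtain \<rho> where \<rho>: "\<rho> \<in> hom (dicyclic_group n) (GL 1)" "\<rho> (dic_x n) = 1\<^sub>m 1" "\<rho> (dic_y n) = ?S"
  proof (rule dicyclic_group_hom[OF group_GL _ b])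
    show "1\<^sub>m 1 \<in> carrier (GL 1)"
      using one_closed by (simp only: GL_one)
    show "1\<^sub>m 1 [^]\<^bsub>GL 1\<^esub> (2 * n) = \<one>\<^bsub>GL 1\<^esub>"
      by (simp only: one_pow GL_one)
    show "?S \<otimes>\<^bsub>GL 1\<^esub> ?S = 1\<^sub>m 1 [^]\<^bsub>GL 1\<^esub> n"
      by (simp only: S GL_mult one_pow)
    show "?S \<otimes>\<^bsub>GL 1\<^esub> 1\<^sub>m 1 = inv\<^bsub>GL 1\<^esub> (1\<^sub>m 1) \<otimes>\<^bsub>GL 1\<^esub> ?S"
      unfolding one_inv by (simp add: GL_mult)
  qed
  then have rep: "representation (dicyclic_group n) 1 \<rho>"
    by (simp add: representation_def)
  have "character_of (dicyclic_group n) \<rho> (dic_elem n i e) = (if e then s else 1)" for i e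
    using n by (simp add: character_of_def dic_elem_closed representation_dic_elem[OF n rep] \<rho>
        one_pow GL_mult mat_trace_def del: One_nat_def)
  moreover have "irreducible_representation (dicyclic_group n) 1 \<rho>"
    using rep by (rule irreducible_representation_1)
  ultimately show thesis
    using that unfolding irreducible_characters_def by blast
qed


section \<open>Virtual characters\<close>

lemma irreducible_character_virtual:
  assumes "\<chi> \<in> irreducible_characters G"
  shows "\<chi> \<in> virtual_characters G"
proof -
  have "\<chi> = (\<lambda>g\<in>carrier G. \<Sum>\<psi>\<in>{\<chi>}. of_int 1 * \<psi> g)"
    using assms by (auto simp: irreducible_characters_def character_of_def)
  then show ?thesis
    using assms unfolding virtual_characters_def
    by (intro CollectI exI[of _ "{\<chi>}"] exI[of _ "\<lambda>_. 1"]) simp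
qed

lemma virtual_characters_add:
  assumes "\<phi> \<in> virtual_characters G" "\<psi> \<in> virtual_characters G"
  shows "(\<lambda>g\<in>carrier G. \<phi> g + \<psi> g) \<in> virtual_characters G"
proof -
  obtain S a where S: "finite S" "S \<subseteq> irreducible_characters G"
    and \<phi>: "\<phi> = (\<lambda>g\<in>carrier G. \<Sum>\<chi>\<in>S. of_int (a \<chi> :: int) * \<chi> g)"
    using assms(1) by (auto simp: virtual_characters_def)
  obtain T b where T: "finite T" "T \<subseteq> irreducible_characters G"
    and \<psi>: "\<psi> = (\<lambda>g\<in>carrier G. \<Sum>\<chi>\<in>T. of_int (b \<chi> :: int) * \<chi> g)"
    using assms(2) by (auto simp: virtual_characters_def)
  define c where "c \<chi> = (if \<chi> \<in> S then a \<chi> else 0) + (if \<chi> \<in> T then b \<chi> else 0)" for \<chi>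
  have "(\<Sum>\<chi>\<in>S. of_int (a \<chi>) * \<chi> g) + (\<Sum>\<chi>\<in>T. of_int (b \<chi>) * \<chi> g) =
      (\<Sum>\<chi>\<in>S \<union> T. of_int (c \<chi>) * \<chi> g)" for g
  proof -
    have "(\<Sum>\<chi>\<in>S. of_int (a \<chi>) * \<chi> g) = (\<Sum>\<chi>\<in>S \<union> T. of_int (if \<chi> \<in> S then a \<chi> else 0) * \<chi> g)"
      using S(1) T(1) by (intro sum.mono_neutral_cong_left) auto
    moreover have "(\<Sum>\<chi>\<in>T. of_int (b \<chi>) * \<chi> g) =
        (\<Sum>\<chi>\<in>S \<union> T. of_int (if \<chi> \<in> T then b \<chi> else 0) * \<chi> g)"
      using S(1) T(1) by (intro sum.mono_neutral_cong_left) auto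
    ultimately show ?thesis
      by (simp only: c_def of_int_add distrib_right sum.distrib)
  qed
  then have "(\<lambda>g\<in>carrier G. \<phi> g + \<psi> g) = (\<lambda>g\<in>carrier G. \<Sum>\<chi>\<in>S \<union> T. of_int (c \<chi>) * \<chi> g)"
    by (auto simp: \<phi> \<psi>)
  then show ?thesis
    using S T unfolding virtual_characters_def by blast
qed

text \<open>
  Repetitions in the list provide multiplicities, and the members need not be known to be distinct.
\<close>

lemma virtual_characters_sum_list:
  assumes "set \<chi>s \<subseteq> virtual_characters G"
  shows "(\<lambda>g\<in>carrier G. \<Sum>\<chi>\<leftarrow>\<chi>s. \<chi> g) \<in> virtual_characters G"
  using assms
proof (induction \<chi>s)
  case Nil
  show ?case
    unfolding virtual_characters_def
    by (intro CollectI exI[of _ "{}"]) (simp add: restrict_def)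
next
  case (Cons \<phi> \<chi>s)
  then have "(\<lambda>g\<in>carrier G. \<phi> g + (\<lambda>g\<in>carrier G. \<Sum>\<chi>\<leftarrow>\<chi>s. \<chi> g) g) \<in> virtual_characters G"
    by (intro virtual_characters_add) simp_all
  moreover have "(\<lambda>g\<in>carrier G. \<phi> g + (\<lambda>g\<in>carrier G. \<Sum>\<chi>\<leftarrow>\<chi>s. \<chi> g) g) =
      (\<lambda>g\<in>carrier G. \<Sum>\<chi>\<leftarrow>\<phi> # \<chi>s. \<chi> g)"
    by auto
  ultimately show ?case by (simp only:)
qed


section \<open>The regular invertible character of the dicyclic group of order 24\<close>

text \<open>
  Clearing denominators turns the product into \<open>(1 + u) (1 + u + \<dots> + u\<^sup>1\<^sup>1)\<close>, and the second factor
  is \<open>(u\<^sup>1\<^sup>2 - 1) / (u - 1)\<close>.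
\<close>

lemma twelfth_root_product_eq_0:
  fixes u :: complex
  assumes "u ^ 12 = 1" "u \<noteq> 1"
  defines "v \<equiv> inverse u"
  shows "(u + v) * (2 + (u + v) + (u ^ 3 + v ^ 3) + (u ^ 5 + v ^ 5) + 2 * (u ^ 4 + v ^ 4)) = 0"
    (is "?P = 0")
proof -
  have "u \<noteq> 0"
    using assms(1) by auto
  then have "(u - 1) * u ^ 6 * ?P = (u + 1) * (u ^ 12 - 1)"
    unfolding v_def by (simp add: eval_nat_numeral field_simps)
  then show ?thesis
    using assms(1,2) \<open>u \<noteq> 0\<close> by simp
qed

lemma sum_cubes_inverse:
  fixes u :: complex
  assumes "u \<noteq> 0"
  shows "u ^ 3 + inverse u ^ 3 = (u + inverse u) * (u\<^sup>2 - 1 + inverse u ^ 2)"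
  using assms by (simp add: power2_eq_square power3_eq_cube algebra_simps)

theorem mainTheorem9:
  shows "order (dicyclic_group 6) = 24 \<and>
    (\<exists>\<chi>\<in>irreducible_characters (dicyclic_group 6).
       regular_invertible (dicyclic_group 6) \<chi> \<and> \<not> minimal_character (dicyclic_group 6) \<chi>)"
proof -
  let ?G = "dicyclic_group 6"
  have order: "order ?G = 24"
    using order_dicyclic_group[of 6] by simp
  then have fin: "finite (carrier ?G)"
    by (intro card_ge_0_finite) (simp add: Coset.order_def)

  obtain z :: complex where z12: "z ^ 12 = 1" and inj: "inj_on (\<lambda>i. z ^ i) {..<12}"
    using primitive_root[of 12] by auto
  have z_ne: "z ^ i \<noteq> 1" if "0 < i" "i < 12" for i
    using inj_onD[OF inj, of i 0] that by auto
  have z0: "z \<noteq> 0"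
    using z12 by auto
  have root: "(z ^ k) ^ (2 * 6) = 1" for k
  proof -
    have "(z ^ k) ^ (2 * 6) = (z ^ 12) ^ k"
      by (simp add: mult.commute flip: power_mult)
    then show ?thesis by (simp add: z12)
  qed
  have nonreal: "(z ^ k)\<^sup>2 \<noteq> 1" if "0 < k" "k < 6" for k
    using z_ne[of "k * 2"] that by (simp add: power_mult)
  have "\<exists>\<chi>\<in>irreducible_characters ?G.
      \<forall>i e. \<chi> (dic_elem 6 i e) = (if e then 0 else (z ^ i) ^ k + inverse (z ^ i) ^ k)"
    if k: "0 < k" "k < 6" for k
  proof -
    have "(z ^ k) ^ i = (z ^ i) ^ k" "inverse (z ^ k) ^ i = inverse (z ^ i) ^ k" for i
      by (simp_all add: power_inverse mult.commute flip: power_mult)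
    then show ?thesis
      using dicyclic_character_2[OF _ root nonreal[OF k]] by (metis zero_less_numeral)
  qed
  then obtain X where X_irr: "\<And>k. 0 < k \<Longrightarrow> k < 6 \<Longrightarrow> X k \<in> irreducible_characters ?G"
    and X: "\<And>k i e. 0 < k \<Longrightarrow> k < 6 \<Longrightarrow>
      X k (dic_elem 6 i e) = (if e then 0 else (z ^ i) ^ k + inverse (z ^ i) ^ k)"
    by metis
  obtain \<tau> where \<tau>: "\<tau> \<in> irreducible_characters ?G" "\<And>i e. \<tau> (dic_elem 6 i e) = 1"
    by (rule dicyclic_character_1[of 6 1]) auto
  obtain \<sigma> where \<sigma>: "\<sigma> \<in> irreducible_characters ?G" "\<And>i e. \<sigma> (dic_elem 6 i e) = (if e then -1 else 1)"
    by (rule dicyclic_character_1[of 6 "-1"]) auto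

  \<comment> \<open>Multiplication by \<open>X 1\<close> sends each \<open>X k\<close> to \<open>X (k - 1) + X (k + 1)\<close>; the multiplicities are
    chosen so that every irreducible character occurs in the product as often as its degree.\<close>
  let ?\<phi> = "\<lambda>g\<in>carrier ?G. \<Sum>\<chi>\<leftarrow>[\<tau>, \<sigma>, X 1, X 3, X 5, X 4, X 4]. \<chi> g"
  have "regular_invertible ?G (X 1)"
    unfolding regular_invertible_def
  proof (intro bexI ballI)
    show "?\<phi> \<in> virtual_characters ?G"
      by (intro virtual_characters_sum_list) (auto intro!: irreducible_character_virtual \<tau> \<sigma> X_irr)
  next
    fix g assume g: "g \<in> carrier ?G"
    then obtain i e where i: "i < 12" and g_eq: "g = dic_elem 6 i e"
      using dic_elem_surj[of 6 g] by auto
    have one_iff: "g = \<one>\<^bsub>?G\<^esub> \<longleftrightarrow> i = 0 \<and> \<not> e"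
      using inj_on_eq_iff[OF inj_on_dic_elem[of 6], of "(i, e)" "(0, False)"] i
      by (simp add: g_eq flip: dic_elem_0)
    have "X 1 g * ?\<phi> g = (if i = 0 \<and> \<not> e then 24 else 0)"
    proof (cases "i = 0 \<or> e")
      case True
      then show ?thesis using g by (auto simp: g_eq X \<tau> \<sigma>)
    next
      case False
      then have "(z ^ i) ^ 12 = 1" "z ^ i \<noteq> 1"
        using z_ne[of i] root[of i] i by simp_all
      note twelfth_root_product_eq_0[OF this]
      moreover have "?\<phi> g = 2 + (z ^ i + inverse (z ^ i)) + ((z ^ i) ^ 3 + inverse (z ^ i) ^ 3) +
          ((z ^ i) ^ 5 + inverse (z ^ i) ^ 5) + 2 * ((z ^ i) ^ 4 + inverse (z ^ i) ^ 4)"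
        using False g by (simp add: g_eq X \<tau> \<sigma>)
      moreover have "X 1 g = z ^ i + inverse (z ^ i)"
        using False by (simp add: g_eq X)
      ultimately show ?thesis
        using False by simp
    qed
    then show "X 1 g * ?\<phi> g = regular_character ?G g"
      using regular_character_eq[OF group_dicyclic_group fin g] by (simp add: order one_iff)
  qed
  moreover have "\<not> minimal_character ?G (X 1)"
  proof
    assume minimal: "minimal_character ?G (X 1)"
    have deg: "char_degree ?G (X k) = 2" if "0 < k" "k < 6" for k
      using X[OF that, of 0 False] by (simp add: char_degree_def dic_elem_0)
    have "X 3 \<in> positive_virtual_characters ?G"
      by (simp add: positive_virtual_characters_def deg irreducible_character_virtual X_irr)
    moreover have "char_le ?G (X 3) (X 1)"
      unfolding char_le_def
    proof (intro conjI ballI impI)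
      fix g assume "g \<in> carrier ?G" and zero: "X 1 g = 0"
      then obtain i e where g_eq: "g = dic_elem 6 i e"
        by (metis dic_elem_surj zero_less_numeral)
      show "X 3 g = 0"
        using zero z0 sum_cubes_inverse[of "z ^ i"] by (cases e) (simp_all add: g_eq X)
    qed (simp add: deg)
    ultimately have "char_le ?G (X 1) (X 3)"
      using minimal by (simp add: minimal_character_def)
    moreover have "X 3 (dic_elem 6 1 False) = 0"
    proof -
      have "(z ^ 6 - 1) * (z ^ 6 + 1) = 0"
        using z12 by (simp add: algebra_simps flip: power_add)
      then have "z ^ 6 + 1 = 0"
        using z_ne[of 6] by simp
      moreover have "z ^ 3 * (z ^ 3 + inverse z ^ 3) = z ^ 6 + 1"
        using z0 by (simp add: distrib_left flip: power_add power_mult_distrib)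
      ultimately show ?thesis
        using z0 by (simp add: X)
    qed
    ultimately have "X 1 (dic_elem 6 1 False) = 0"
      using dic_elem_closed[of 6] by (simp add: char_le_def)
    then have "z * (z + inverse z) = 0"
      by (simp add: X)
    then have "z\<^sup>2 + 1 = 0"
      using z0 by (simp add: distrib_left power2_eq_square)
    then have "z\<^sup>2 = -1"
      by (simp add: eq_neg_iff_add_eq_0)
    then have "z ^ 4 = 1"
      using power_mult[of z 2 2] by simp
    then show False
      using z_ne[of 4] by simp
  qed
  ultimately show ?thesis
    using order X_irr[of 1] by auto
qed

end
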